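(* Fix the number of agents $n$. There are constants $C,K>0$ depending only on $n$ such that, for every adaptive adversary with $\mathrm{Opt}:=\mathbb{E}[\mathrm{OPT}(\sigma)]\ge K$, the algorithm Random satisfies $$\mathbb{E}[\mathrm{Random}(\sigma)]\ \ge\ \frac{\mathrm{Opt}}{n}-C\sqrt{\mathrm{Opt}\cdot\log \mathrm{Opt}},$$ where $\sigma$ is the (random) input sequence chosen by the adversary in response to the random choices of Random.
   Context: Setting (online max-min fair allocation). There are agents $N=\{1,\dots,n\}$; items arrive one by one, and each must be irrevocably given to one agent on arrival. Agent $i$ values item $e$ at $v_i(e)\in[0,1]$, and $v_i(X)=\sum_{e\in X}v_i(e)$. For an input sequence $\sigma$, $\mathrm{OPT}(\sigma)$ is the maximum over all allocations (partitions $(A_1,\dots,A_n)$ of the items of $\sigma$) of $\min_{i\in N}v_i(A_i)$. Random is the online algorithm that gives each arriving item to an agent chosen uniformly at random from $N$, independently of everything before. $\mathrm{Random}(\sigma)$ denotes $\min_{i\in N}v_i(A_i)$ for the resulting allocation. An adaptive adversary decides, at each time, as a function of the sequence of allocation decisions made so far by the algorithm, either to request a next item (choosing its value vector in $[0,1]^n$) or to terminate; $\sigma$ is the resulting sequence of items, assumed finite (almost surely), with $\mathrm{Opt}$ finite. The offline optimum $\mathrm{OPT}(\sigma)$ is evaluated on the realized sequence. Expectations are over the randomness of Random. *)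

theory Defs
  imports "HOL-Probability.Probability"
begin

text \<open>Agents are \<open>0, \<dots>, n - 1\<close>. An item is its value vector \<open>v\<close>, with \<open>v i\<close> the value for
  agent \<open>i\<close>; only the entries with \<open>i < n\<close> matter. In a sequence of items the individual
  items are referred to by their positions, so that repeated value vectors stay distinct items.\<close>

type_synonym item = "nat \<Rightarrow> real"

definition bundle_value :: "item list \<Rightarrow> nat \<Rightarrow> nat set \<Rightarrow> real" where
  "bundle_value \<sigma> i X = (\<Sum>e\<in>X. (\<sigma> ! e) i)"

definition allocations :: "nat \<Rightarrow> nat \<Rightarrow> (nat \<Rightarrow> nat set) set" where
  "allocations n m = {A \<in> {..<n} \<rightarrow>\<^sub>E Pow {..<m}.
     disjoint_family_on A {..<n} \<and> (\<Union>i<n. A i) = {..<m}}"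

definition min_value :: "nat \<Rightarrow> item list \<Rightarrow> (nat \<Rightarrow> nat set) \<Rightarrow> real" where
  "min_value n \<sigma> A = Min ((\<lambda>i. bundle_value \<sigma> i (A i)) ` {..<n})"

definition OPT :: "nat \<Rightarrow> item list \<Rightarrow> real" where
  "OPT n \<sigma> = Max (min_value n \<sigma> ` allocations n (length \<sigma>))"

text \<open>An adaptive adversary maps the list of past decisions (oldest first; the \<open>t\<close>-th entry is
  the agent who received item \<open>t\<close>) to the next item, or to \<open>None\<close> in order to terminate.\<close>

type_synonym adversary = "nat list \<Rightarrow> item option"

definition valid_adversary :: "nat \<Rightarrow> adversary \<Rightarrow> bool" where
  "valid_adversary n adv \<longleftrightarrow>
     (\<forall>h v. set h \<subseteq> {..<n} \<longrightarrow> adv h = Some v \<longrightarrow> (\<forall>i<n. 0 \<le> v i \<and> v i \<le> 1))"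

text \<open>The random choices of Random: \<open>\<omega> t\<close> is the agent to whom item \<open>t\<close> is given if it is
  requested. Choices beyond the time of termination are never used.\<close>

definition choices :: "nat \<Rightarrow> (nat \<Rightarrow> nat) measure" where
  "choices n = PiM UNIV (\<lambda>_::nat. measure_pmf (pmf_of_set {..<n}))"

definition history :: "(nat \<Rightarrow> nat) \<Rightarrow> nat \<Rightarrow> nat list" where
  "history \<omega> t = map \<omega> [0..<t]"

definition terminates :: "adversary \<Rightarrow> (nat \<Rightarrow> nat) \<Rightarrow> bool" where
  "terminates adv \<omega> \<longleftrightarrow> (\<exists>t. adv (history \<omega> t) = None)"

text \<open>The following definitions are meaningful only for \<open>\<omega>\<close> with \<^term>\<open>terminates adv \<omega>\<close>.\<close>

definition num_items :: "adversary \<Rightarrow> (nat \<Rightarrow> nat) \<Rightarrow> nat" where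
  "num_items adv \<omega> = (LEAST t. adv (history \<omega> t) = None)"

definition input_seq :: "adversary \<Rightarrow> (nat \<Rightarrow> nat) \<Rightarrow> item list" where
  "input_seq adv \<omega> = map (\<lambda>t. the (adv (history \<omega> t))) [0..<num_items adv \<omega>]"

definition random_allocation :: "nat \<Rightarrow> adversary \<Rightarrow> (nat \<Rightarrow> nat) \<Rightarrow> nat \<Rightarrow> nat set" where
  "random_allocation n adv \<omega> = (\<lambda>i\<in>{..<n}. {t. t < num_items adv \<omega> \<and> \<omega> t = i})"

definition Random :: "nat \<Rightarrow> adversary \<Rightarrow> (nat \<Rightarrow> nat) \<Rightarrow> real" where
  "Random n adv \<omega> = min_value n (input_seq adv \<omega>) (random_allocation n adv \<omega>)"

lemma prob_space_choices: "prob_space (choices n)"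
  unfolding choices_def by (intro prob_space_PiM measure_pmf.prob_space_axioms)

lemma finite_allocations: "finite (allocations n m)"
  unfolding allocations_def by (rule finite_subset[of _ "{..<n} \<rightarrow>\<^sub>E Pow {..<m}"]) (auto intro: finite_PiE)

lemma random_allocation_in_allocations:
  assumes "\<And>t. \<omega> t < n"
  shows "random_allocation n adv \<omega> \<in> allocations n (length (input_seq adv \<omega>))"
  using assms unfolding allocations_def random_allocation_def input_seq_def
  by (auto simp: disjoint_family_on_def)

end

theory Submission
  imports Defs
begin

text \<open>
  Fix an agent \<open>i\<close>, let \<open>V\<close> be her value for the whole input and \<open>A\<close> her value for what she
  receives. For \<open>l \<ge> 0\<close> and \<open>c = (1 - l / 2) / n\<close> the process \<open>exp (l * (c * V - A))\<close>, evaluated on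
  the items that have arrived so far, is a nonnegative supermartingale starting at 1 whatever the
  adversary does, so by Fatou its expectation at the time of termination is at most 1. From
  \<open>x \<le> exp x\<close> and \<open>V \<ge> OPT\<close> one obtains
  \<open>min A \<ge> c * OPT - (1 / l) * (\<Sum>i<n. exp (l * (c * V - A)))\<close>, hence
  \<open>E Random \<ge> c * Opt - n / l\<close>, and \<open>l = 1 / sqrt Opt\<close> gives an error of order \<open>sqrt Opt\<close>, which is
  even smaller than the claimed one.
\<close>

subsection \<open>Supermartingales driven by an adaptive adversary\<close>

text \<open>This is the stopped multiplicative process: it starts at 1, gains one factor per item
  and is frozen at termination. The recursion removes the oldest decision and continues with the
  residual adversary, which suits induction over all adversaries by conditioning on the first
  decision.\<close>

primrec potential :: "(item \<Rightarrow> nat \<Rightarrow> real) \<Rightarrow> adversary \<Rightarrow> nat list \<Rightarrow> real" where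
  "potential w adv [] = 1"
| "potential w adv (s # h) = (case adv [] of None \<Rightarrow> 1
     | Some v \<Rightarrow> w v s * potential w (\<lambda>h. adv (s # h)) h)"

lemma potential_nonneg:
  assumes "\<And>v s. 0 \<le> w v s"
  shows "0 \<le> potential w adv h"
  using assms by (induction h arbitrary: adv) (auto split: option.split)

lemma potential_eq_prod:
  assumes "adv (take N h) = None" "\<And>t. t < N \<Longrightarrow> adv (take t h) \<noteq> None" "N \<le> length h"
  shows "potential w adv h = (\<Prod>t<N. w (the (adv (take t h))) (h ! t))"
  using assms
proof (induction h arbitrary: adv N)
  case Nil
  then show ?case by simp
next
  case (Cons s h)
  show ?case
  proof (cases N)
    case 0
    with Cons.prems show ?thesis by simp
  next
    case (Suc M)
    have "potential w (\<lambda>h. adv (s # h)) h = (\<Prod>t<M. w (the (adv (s # take t h))) (h ! t))"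
      using Cons.prems Cons.prems(2)[of "Suc t" for t] unfolding Suc by (intro Cons.IH) auto
    moreover obtain v where "adv [] = Some v"
      using Cons.prems(2)[of 0] Suc by auto
    ultimately show ?thesis
      unfolding Suc by (simp add: prod.lessThan_Suc_shift del: prod.lessThan_Suc)
  qed
qed

lemma valid_adversary_Cons:
  assumes "valid_adversary n adv" "s < n"
  shows "valid_adversary n (\<lambda>h. adv (s # h))"
  unfolding valid_adversary_def
proof (intro allI impI)
  fix h v i
  assume "set h \<subseteq> {..<n}" "adv (s # h) = Some v" "i < n"
  then show "0 \<le> v i \<and> v i \<le> 1"
    using assms(1)[unfolded valid_adversary_def, rule_format, of "s # h" v i] assms(2) by auto
qed

section \<open>Histories on the space of choices: measurability and conditioning on the first
  decision\<close>

lemma history_case_nat: "history (case_nat s \<omega>) (Suc k) = s # history \<omega> k"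
  unfolding history_def by (simp add: upt_conv_Cons map_Suc_upt[symmetric] del: upt_Suc)

lemma measurable_choices_component: "(\<lambda>\<omega>. \<omega> t) \<in> choices n \<rightarrow>\<^sub>M count_space UNIV"
  unfolding choices_def by simp

lemma measurable_history: "(\<lambda>\<omega>. history \<omega> k) \<in> choices n \<rightarrow>\<^sub>M count_space UNIV"
proof (induction k)
  case 0
  then show ?case by (simp add: history_def)
next
  case (Suc k)
  have "(\<lambda>\<omega>. (\<lambda>p. fst p @ [snd p]) (history \<omega> k, \<omega> k)) \<in> choices n \<rightarrow>\<^sub>M count_space UNIV"
    by (rule measurable_compose[OF measurable_Pair[OF Suc measurable_choices_component]])
       (simp add: pair_measure_countable)
  then show ?case by (simp add: history_def)
qed

text \<open>Histories live in a countable type with the discrete sigma-algebra, so an arbitrary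
  \<open>F\<close>, such as one built from an adversary, is covered.\<close>

lemma borel_measurable_of_history:
  fixes F :: "nat list \<Rightarrow> 'a::topological_space"
  shows "(\<lambda>\<omega>. F (history \<omega> k)) \<in> borel_measurable (choices n)"
  by (rule measurable_compose[OF measurable_history]) simp

text \<open>The sequence space is the image of one factor times itself under
  \<open>case_nat\<close>; integrating out the uniform first coordinate leaves an average over the
  agents.\<close>

lemma nn_integral_choices_iter:
  assumes n: "n \<ge> 1" and f: "f \<in> borel_measurable (choices n)"
  shows "(\<integral>\<^sup>+\<omega>. f \<omega> \<partial>choices n) = (\<Sum>s<n. \<integral>\<^sup>+\<omega>. f (case_nat s \<omega>) \<partial>choices n) / of_nat n"
proof -
  let ?M = "measure_pmf (pmf_of_set {..<n})"
  interpret sequence_space ?M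
    by unfold_locales
  have S: "choices n = S" by (simp add: choices_def)
  have m: "(\<lambda>(s, \<omega>). case_nat s \<omega>) \<in> ?M \<Otimes>\<^sub>M S \<rightarrow>\<^sub>M S"
    by measurable
  have ne: "{..<n} \<noteq> {}" using n by (auto simp: lessThan_empty_iff)
  have "(\<integral>\<^sup>+\<omega>. f \<omega> \<partial>S) = (\<integral>\<^sup>+\<omega>. f \<omega> \<partial>distr (?M \<Otimes>\<^sub>M S) S (\<lambda>(s, \<omega>). case_nat s \<omega>))"
    by (simp only: PiM_iter)
  also have "\<dots> = (\<integral>\<^sup>+p. f (case p of (s, \<omega>) \<Rightarrow> case_nat s \<omega>) \<partial>(?M \<Otimes>\<^sub>M S))"
    using f m by (intro nn_integral_distr) (auto simp: S)
  also have "\<dots> = (\<integral>\<^sup>+s. \<integral>\<^sup>+\<omega>. f (case_nat s \<omega>) \<partial>S \<partial>?M)"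
    using measurable_compose[OF m f[unfolded S]]
    by (subst P.nn_integral_fst[symmetric]) auto
  also have "\<dots> = (\<Sum>s<n. \<integral>\<^sup>+\<omega>. f (case_nat s \<omega>) \<partial>S) / of_nat n"
    using ne by (subst nn_integral_pmf_of_set) auto
  finally show ?thesis unfolding S .
qed

text \<open>The assumption on \<open>w\<close> is the supermartingale property: the mean factor of
  any admissible item is at most 1. After conditioning on the first decision, the induction
  hypothesis is applied to the residual adversary.\<close>

lemma nn_integral_potential_le_1:
  assumes n: "n \<ge> 1" and w0: "\<And>v s. 0 \<le> w v s"
    and w: "\<And>v. (\<And>i. i < n \<Longrightarrow> 0 \<le> v i \<and> v i \<le> 1) \<Longrightarrow> (\<Sum>s<n. w v s) \<le> real n"
    and "valid_adversary n adv"
  shows "(\<integral>\<^sup>+\<omega>. ennreal (potential w adv (history \<omega> k)) \<partial>choices n) \<le> 1"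
  using assms(4)
proof (induction k arbitrary: adv)
  case 0
  interpret prob_space "choices n" by (rule prob_space_choices)
  show ?case by (simp add: history_def emeasure_space_1)
next
  case (Suc k)
  interpret prob_space "choices n" by (rule prob_space_choices)
  show ?case
  proof (cases "adv []")
    case None
    have "potential w adv (history \<omega> (Suc k)) = 1" for \<omega>
      by (cases "history \<omega> (Suc k)") (auto simp: None)
    then show ?thesis by (simp add: emeasure_space_1)
  next
    case (Some v)
    have v: "0 \<le> v i \<and> v i \<le> 1" if "i < n" for i
      using Suc.prems Some that unfolding valid_adversary_def
      by (metis empty_set empty_subsetI)
    have "(\<integral>\<^sup>+\<omega>. ennreal (potential w adv (history \<omega> (Suc k))) \<partial>choices n) =
        (\<Sum>s<n. \<integral>\<^sup>+\<omega>. ennreal (w v s) *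
           ennreal (potential w (\<lambda>h. adv (s # h)) (history \<omega> k)) \<partial>choices n) / of_nat n"
      by (subst nn_integral_choices_iter[OF n])
         (auto simp: history_case_nat Some ennreal_mult w0 potential_nonneg
           intro: borel_measurable_of_history)
    also have "\<dots> = (\<Sum>s<n. ennreal (w v s) *
        (\<integral>\<^sup>+\<omega>. ennreal (potential w (\<lambda>h. adv (s # h)) (history \<omega> k)) \<partial>choices n)) / of_nat n"
      by (subst nn_integral_cmult) (auto intro: borel_measurable_of_history)
    also have "\<dots> \<le> (\<Sum>s<n. ennreal (w v s) * 1) / of_nat n"
      using Suc.IH[OF valid_adversary_Cons[OF Suc.prems]]
      by (intro divide_right_mono_ennreal sum_mono mult_left_mono) auto
    also have "\<dots> = ennreal (\<Sum>s<n. w v s) / of_nat n"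
      by (simp add: sum_ennreal w0)
    also have "\<dots> \<le> ennreal (real n) / of_nat n"
      using w[OF v] by (intro divide_right_mono_ennreal ennreal_leI) auto
    also have "\<dots> = 1"
      using n by (simp add: ennreal_of_nat_eq_real_of_nat divide_ennreal)
    finally show ?thesis .
  qed
qed

subsection \<open>The exponential supermartingale of an agent\<close>

text \<open>Multiply by \<open>exp y\<close> and use its quadratic Taylor lower bound: the product
  of the two quadratics is \<open>1 + y ^ 4 / 4\<close>.\<close>

lemma exp_minus_le_quadratic:
  fixes y :: real
  assumes "0 \<le> y"
  shows "exp (- y) \<le> 1 - y + y\<^sup>2 / 2"
proof -
  have "1 \<le> 1 + y ^ 4 / 4" by simp
  also have "\<dots> = (1 - y + y\<^sup>2 / 2) * (1 + y + y\<^sup>2 / 2)"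
    by (simp add: algebra_simps power2_eq_square power4_eq_xxxx)
  also have "\<dots> \<le> (1 - y + y\<^sup>2 / 2) * exp y"
  proof (rule mult_left_mono)
    show "1 + y + y\<^sup>2 / 2 \<le> exp y" using exp_lower_Taylor_quadratic[OF assms] by simp
    \<comment> \<open>Twice this quadratic is \<open>1 + (1 - y)^2\<close>.\<close>
    show "0 \<le> 1 - y + y\<^sup>2 / 2"
      using zero_le_power2[of "1 - y"] by (simp add: power2_diff)
  qed
  finally show ?thesis by (simp add: exp_minus field_simps)
qed

text \<open>This is the supermartingale property for an item of value \<open>x\<close> to agent
  \<open>i\<close>. The correction \<open>l / 2\<close> in the coefficient pays for the quadratic
  term of \<open>exp (- (l * x))\<close>.\<close>

lemma sum_exp_factor_le:
  fixes l x :: real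
  assumes i: "i < n" and l: "0 \<le> l" and x: "0 \<le> x" "x \<le> 1"
  shows "(\<Sum>s<n. exp (l * ((1 - l / 2) / n * x - (if s = i then x else 0)))) \<le> real n"
proof -
  define a where "a = l * ((1 - l / 2) / n * x)"
  have n: "real n > 0" using i by simp
  have "(\<Sum>s<n. exp (l * ((1 - l / 2) / n * x - (if s = i then x else 0))))
      = (\<Sum>s<n. exp a * (if s = i then exp (- (l * x)) else 1))"
    by (intro sum.cong) (auto simp: a_def algebra_simps simp flip: exp_add)
  also have "\<dots> = exp a * (exp (- (l * x)) + (real n - 1))"
    using i by (simp add: sum_distrib_left[symmetric] sum.remove[of _ i] of_nat_diff)
  also have "\<dots> \<le> exp a * (n * exp (- a))"
  proof (rule mult_left_mono)
    \<comment> \<open>Since \<open>x \<le> 1\<close>, the quadratic term is at most linear in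
      \<open>x\<close>, so one coefficient works for all items.\<close>
    have "(l * x)\<^sup>2 \<le> l\<^sup>2 * x"
      using x unfolding power_mult_distrib
      by (intro mult_left_mono) (auto simp: power2_eq_square mult_left_le)
    moreover have "real n * a = l * x - l\<^sup>2 * x / 2"
      using n by (simp add: a_def field_simps power2_eq_square)
    ultimately have "exp (- (l * x)) + (real n - 1) \<le> n * (1 - a)"
      using exp_minus_le_quadratic[of "l * x"] l x by (simp add: right_diff_distrib)
    also have "\<dots> \<le> n * exp (- a)"
      using exp_ge_add_one_self[of "- a"] n by (intro mult_left_mono) auto
    finally show "exp (- (l * x)) + (real n - 1) \<le> n * exp (- a)" .
  qed simp
  also have "\<dots> = n" by (simp add: exp_minus)
  finally show ?thesis .
qed

definition deficit :: "nat \<Rightarrow> adversary \<Rightarrow> real \<Rightarrow> nat \<Rightarrow> (nat \<Rightarrow> nat) \<Rightarrow> real" where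
  "deficit n adv c i \<omega> =
     c * bundle_value (input_seq adv \<omega>) i {..<num_items adv \<omega>} -
     bundle_value (input_seq adv \<omega>) i (random_allocation n adv \<omega> i)"

lemma input_seq_nth: "t < num_items adv \<omega> \<Longrightarrow> input_seq adv \<omega> ! t = the (adv (history \<omega> t))"
  by (simp add: input_seq_def)

lemma deficit_eq_sum:
  assumes "i < n"
  shows "deficit n adv c i \<omega> = (\<Sum>t<num_items adv \<omega>.
    c * the (adv (history \<omega> t)) i - (if \<omega> t = i then the (adv (history \<omega> t)) i else 0))"
proof -
  let ?v = "\<lambda>t. the (adv (history \<omega> t)) i"
  have "bundle_value (input_seq adv \<omega>) i (random_allocation n adv \<omega> i)
      = (\<Sum>t\<in>{t. t \<in> {..<num_items adv \<omega>} \<and> \<omega> t = i}. ?v t)"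
    using assms by (auto simp: bundle_value_def random_allocation_def input_seq_nth intro!: sum.cong)
  also have "\<dots> = (\<Sum>t<num_items adv \<omega>. if \<omega> t = i then ?v t else 0)"
    by (subst sum.inter_filter) auto
  finally show ?thesis
    by (simp add: deficit_def sum_subtractf sum_distrib_left bundle_value_def input_seq_nth)
qed

text \<open>The deficit is additive over items, so its exponential is the product of the factors. On
  a terminating run the potential is therefore eventually constant in \<open>k\<close>.\<close>

lemma potential_history_eq_exp_deficit:
  assumes "i < n" "terminates adv \<omega>" "num_items adv \<omega> \<le> k"
  shows "potential (\<lambda>v s. exp (l * (c * v i - (if s = i then v i else 0)))) adv (history \<omega> k)
    = exp (l * deficit n adv c i \<omega>)"
proof -
  let ?N = "num_items adv \<omega>"
  have tk: "take t (history \<omega> k) = history \<omega> t" if "t \<le> ?N" for t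
    using that assms(3) by (simp add: history_def take_map)
  have "adv (history \<omega> ?N) = None"
    using assms(2) unfolding terminates_def num_items_def by (rule LeastI_ex)
  moreover have "adv (history \<omega> t) \<noteq> None" if "t < ?N" for t
    using not_less_Least[of t "\<lambda>t. adv (history \<omega> t) = None"] that by (simp add: num_items_def)
  ultimately have "potential (\<lambda>v s. exp (l * (c * v i - (if s = i then v i else 0)))) adv (history \<omega> k)
    = (\<Prod>t<?N. exp (l * (c * the (adv (take t (history \<omega> k))) i
         - (if history \<omega> k ! t = i then the (adv (take t (history \<omega> k))) i else 0))))"
    using assms(3) by (intro potential_eq_prod) (simp_all add: tk, simp add: history_def)
  also have "\<dots> = (\<Prod>t<?N. exp (l * (c * the (adv (history \<omega> t)) i
         - (if \<omega> t = i then the (adv (history \<omega> t)) i else 0))))"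
  proof (intro prod.cong refl)
    fix t assume t: "t \<in> {..<?N}"
    then have "history \<omega> k ! t = \<omega> t"
      using assms(3) by (simp add: history_def)
    then show "exp (l * (c * the (adv (take t (history \<omega> k))) i
         - (if history \<omega> k ! t = i then the (adv (take t (history \<omega> k))) i else 0)))
      = exp (l * (c * the (adv (history \<omega> t)) i
         - (if \<omega> t = i then the (adv (history \<omega> t)) i else 0)))"
      using t by (simp add: tk)
  qed
  finally show ?thesis
    using assms(1) by (simp add: deficit_eq_sum sum_distrib_left exp_sum)
qed

lemma nn_integral_exp_deficit_le_1:
  assumes n: "n \<ge> 1" and adv: "valid_adversary n adv" and i: "i < n" and l: "0 \<le> l"
    and ends: "AE \<omega> in choices n. terminates adv \<omega>"
  shows "(\<integral>\<^sup>+\<omega>. ennreal (exp (l * deficit n adv ((1 - l / 2) / n) i \<omega>)) \<partial>choices n) \<le> 1"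
proof -
  define w where "w = (\<lambda>(v :: item) s.
    exp (l * ((1 - l / 2) / n * v i - (if s = i then v i else 0))))"
  let ?u = "\<lambda>k \<omega>. ennreal (potential w adv (history \<omega> k))"
  have "(\<integral>\<^sup>+\<omega>. ennreal (exp (l * deficit n adv ((1 - l / 2) / n) i \<omega>)) \<partial>choices n)
      = (\<integral>\<^sup>+\<omega>. liminf (\<lambda>k. ?u k \<omega>) \<partial>choices n)"
  proof (rule nn_integral_cong_AE, rule AE_mp[OF ends], intro AE_I2 impI)
    fix \<omega> assume t: "terminates adv \<omega>"
    have "\<forall>\<^sub>F k in sequentially. ?u k \<omega> = ennreal (exp (l * deficit n adv ((1 - l / 2) / n) i \<omega>))"
      using potential_history_eq_exp_deficit[OF i t, where l = l and c = "(1 - l / 2) / n"]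
      unfolding w_def eventually_sequentially by (intro exI[of _ "num_items adv \<omega>"]) simp
    then have "(\<lambda>k. ?u k \<omega>) \<longlonglongrightarrow> ennreal (exp (l * deficit n adv ((1 - l / 2) / n) i \<omega>))"
      by (rule tendsto_eventually)
    then show "ennreal (exp (l * deficit n adv ((1 - l / 2) / n) i \<omega>)) = liminf (\<lambda>k. ?u k \<omega>)"
      by (intro lim_imp_Liminf[symmetric]) auto
  qed
  \<comment> \<open>The number of items may be unbounded over the runs. Fatou carries the bound for
    each fixed \<open>k\<close> to termination, and an upper bound is all that is required.\<close>
  also have "\<dots> \<le> liminf (\<lambda>k. \<integral>\<^sup>+\<omega>. ?u k \<omega> \<partial>choices n)"
    by (intro nn_integral_liminf borel_measurable_of_history)
  also have "\<dots> \<le> liminf (\<lambda>k. 1 :: ennreal)"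
  proof (intro Liminf_mono always_eventually allI)
    fix k
    show "(\<integral>\<^sup>+\<omega>. ?u k \<omega> \<partial>choices n) \<le> 1"
      using sum_exp_factor_le[OF i l] i adv
      by (intro nn_integral_potential_le_1[OF n]) (auto simp: w_def)
  qed
  also have "\<dots> = 1" by (simp add: Liminf_const)
  finally show ?thesis .
qed

subsection \<open>Measurability and integrability\<close>

text \<open>Without termination \<^const>\<open>num_items\<close> is the junk value of \<open>LEAST\<close> on an empty predicate,
  a constant, which does no harm to measurability.\<close>

lemma measurable_num_items: "num_items adv \<in> choices n \<rightarrow>\<^sub>M count_space UNIV"
  unfolding num_items_def
  by (intro measurable_Least measurable_compose[OF measurable_history]) auto

text \<open>The realized input and the allocation are both functions of this countably valued
  variable, so the measurability of \<open>Random\<close> and \<open>deficit\<close> reduces to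
  it.\<close>

lemma measurable_final_history:
  "(\<lambda>\<omega>. history \<omega> (num_items adv \<omega>)) \<in> choices n \<rightarrow>\<^sub>M count_space UNIV"
  by (rule measurable_compose_countable[OF measurable_history measurable_num_items])

lemma input_seq_eq_final_history:
  fixes adv \<omega>
  defines "h \<equiv> history \<omega> (num_items adv \<omega>)"
  shows "input_seq adv \<omega> = map (\<lambda>t. the (adv (take t h))) [0..<length h]"
  by (auto simp: input_seq_def h_def history_def take_map)

lemma random_allocation_eq_final_history:
  fixes adv \<omega>
  defines "h \<equiv> history \<omega> (num_items adv \<omega>)"
  shows "random_allocation n adv \<omega> = (\<lambda>i\<in>{..<n}. {t. t < length h \<and> h ! t = i})"
  by (auto simp: random_allocation_def h_def history_def intro!: restrict_ext)

lemma borel_measurable_Random: "Random n adv \<in> borel_measurable (choices n)"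
  unfolding Random_def random_allocation_eq_final_history input_seq_eq_final_history
  by (rule measurable_compose[OF measurable_final_history]) simp

lemma borel_measurable_deficit: "deficit n adv c i \<in> borel_measurable (choices n)"
proof -
  have N: "num_items adv \<omega> = length (history \<omega> (num_items adv \<omega>))" for \<omega>
    by (simp add: history_def)
  show ?thesis
    unfolding deficit_def random_allocation_eq_final_history input_seq_eq_final_history
    \<comment> \<open>The index range \<open>{..<num_items adv \<omega>}\<close> must also be
      expressed through the final history, so that the deficit depends on nothing else.\<close>
    by (subst (2) N, rule measurable_compose[OF measurable_final_history]) simp
qed

text \<open>Coordinates range over all of \<open>nat\<close>, so decisions are agents only up to a
  null set. The pointwise bounds below assume this and are later used almost everywhere.\<close>

lemma AE_choices_less:
  assumes "n \<ge> 1"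
  shows "AE \<omega> in choices n. \<forall>t. \<omega> t < n"
proof -
  have ne: "{..<n} \<noteq> {}" using assms by (auto simp: lessThan_empty_iff)
  have "AE \<omega> in choices n. \<omega> t < n" for t
    unfolding choices_def
    by (rule AE_PiM_component) (use ne in \<open>auto simp: AE_measure_pmf_iff measure_pmf.prob_space_axioms\<close>)
  then show ?thesis by (simp add: AE_all_countable)
qed

section \<open>Pointwise bounds for Random\<close>

lemma input_seq_values:
  assumes "valid_adversary n adv" "\<And>t. \<omega> t < n" "i < n" "t < num_items adv \<omega>"
  shows "0 \<le> (input_seq adv \<omega> ! t) i"
proof -
  obtain v where v: "adv (history \<omega> t) = Some v"
    using not_less_Least[of t "\<lambda>t. adv (history \<omega> t) = None"] assms(4) by (auto simp: num_items_def)
  moreover have "set (history \<omega> t) \<subseteq> {..<n}" using assms(2) by (auto simp: history_def)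
  ultimately have "0 \<le> v i"
    using assms(1,3) unfolding valid_adversary_def by blast
  with v show ?thesis using assms(4) by (simp add: input_seq_nth)
qed

lemma Random_bounds:
  assumes n: "n \<ge> 1" and adv: "valid_adversary n adv"
    and \<omega>: "\<And>t. \<omega> t < n"
  shows "0 \<le> Random n adv \<omega>" "Random n adv \<omega> \<le> OPT n (input_seq adv \<omega>)"
    and "\<And>l. 0 < l \<Longrightarrow> l \<le> 2 \<Longrightarrow>
      (1 - l / 2) / n * OPT n (input_seq adv \<omega>)
        - (\<Sum>i<n. exp (l * deficit n adv ((1 - l / 2) / n) i \<omega>)) / l \<le> Random n adv \<omega>"
proof -
  let ?\<sigma> = "input_seq adv \<omega>" and ?N = "num_items adv \<omega>" and ?R = "random_allocation n adv \<omega>"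
  have len: "length ?\<sigma> = ?N" by (simp add: input_seq_def)
  have ne: "{..<n} \<noteq> {}" using n by (auto simp: lessThan_empty_iff)
  note nonneg = input_seq_values[OF adv \<omega>]
  have R: "?R \<in> allocations n (length ?\<sigma>)"
    using \<omega> by (rule random_allocation_in_allocations)
  show "0 \<le> Random n adv \<omega>"
    unfolding Random_def min_value_def bundle_value_def using ne
    by (subst Min_ge_iff) (auto simp: random_allocation_def intro!: sum_nonneg nonneg)
  show "Random n adv \<omega> \<le> OPT n ?\<sigma>"
    unfolding Random_def OPT_def using R by (intro Max_ge) (auto simp: finite_allocations)
  \<comment> \<open>In any allocation the minimum is at most the share of agent \<open>i\<close>,
    which by nonnegativity is at most her value for the whole input.\<close>
  have opt: "OPT n ?\<sigma> \<le> bundle_value ?\<sigma> i {..<?N}" if i: "i < n" for i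
    unfolding OPT_def
  proof (subst Max_le_iff; (intro ballI)?)
    show "min_value n ?\<sigma> ` allocations n (length ?\<sigma>) \<noteq> {}" using R by auto
    fix x assume "x \<in> min_value n ?\<sigma> ` allocations n (length ?\<sigma>)"
    then obtain A where A: "A \<in> allocations n (length ?\<sigma>)" "x = min_value n ?\<sigma> A" by auto
    have "x \<le> bundle_value ?\<sigma> i (A i)"
      unfolding A(2) min_value_def using i by (intro Min_le) auto
    also have "\<dots> \<le> bundle_value ?\<sigma> i {..<?N}"
      unfolding bundle_value_def using A(1) i nonneg[OF i]
      by (intro sum_mono2) (auto simp: allocations_def len PiE_iff)
    finally show "x \<le> bundle_value ?\<sigma> i {..<?N}" .
  qed (simp add: finite_allocations)
  fix l :: real assume l: "0 < l" "l \<le> 2"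
  define c where "c = (1 - l / 2) / n"
  let ?Y = "\<lambda>i. exp (l * deficit n adv c i \<omega>)"
  \<comment> \<open>Here \<open>l \<le> 2\<close> enters; the sign is needed to multiply
    \<open>opt\<close> by \<open>c\<close>.\<close>
  have c: "0 \<le> c" using l by (simp add: c_def)
  have "c * OPT n ?\<sigma> - (\<Sum>i<n. ?Y i) / l \<le> bundle_value ?\<sigma> i (?R i)" if i: "i < n" for i
  proof -
    \<comment> \<open>The sum of all exponentials dominates each one, giving a single error term for
      every agent and hence for the minimum.\<close>
    have "l * deficit n adv c i \<omega> \<le> ?Y i"
      using exp_ge_add_one_self[of "l * deficit n adv c i \<omega>"] by linarith
    also have "\<dots> \<le> (\<Sum>i<n. ?Y i)" using i by (intro member_le_sum) auto
    finally have "deficit n adv c i \<omega> \<le> (\<Sum>i<n. ?Y i) / l" using l by (simp add: field_simps)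
    moreover have "c * OPT n ?\<sigma> \<le> c * bundle_value ?\<sigma> i {..<?N}"
      using opt[OF i] c by (rule mult_left_mono)
    ultimately show ?thesis by (simp add: deficit_def)
  qed
  then have "c * OPT n ?\<sigma> - (\<Sum>i<n. ?Y i) / l \<le> Random n adv \<omega>"
    unfolding Random_def min_value_def using ne by (subst Min_ge_iff) auto
  then show "(1 - l / 2) / n * OPT n ?\<sigma>
      - (\<Sum>i<n. exp (l * deficit n adv ((1 - l / 2) / n) i \<omega>)) / l \<le> Random n adv \<omega>"
    by (simp add: c_def)
qed

section \<open>Passing to expectations and choosing the parameter\<close>

lemma expected_Random_ge:
  assumes n: "n \<ge> 1" and adv: "valid_adversary n adv"
    and ends: "AE \<omega> in choices n. terminates adv \<omega>"
    and int: "integrable (choices n) (\<lambda>\<omega>. OPT n (input_seq adv \<omega>))"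
    and l: "0 < l" "l \<le> 2"
  shows "(1 - l / 2) / n * (\<integral>\<omega>. OPT n (input_seq adv \<omega>) \<partial>choices n) - n / l
    \<le> (\<integral>\<omega>. Random n adv \<omega> \<partial>choices n)"
proof -
  let ?Y = "\<lambda>i \<omega>. exp (l * deficit n adv ((1 - l / 2) / n) i \<omega>)"
  have Y_nn: "(\<integral>\<^sup>+\<omega>. ennreal (?Y i \<omega>) \<partial>choices n) \<le> 1" if "i < n" for i
    using nn_integral_exp_deficit_le_1[OF n adv that _ ends] l by simp
  have Y_meas: "?Y i \<in> borel_measurable (choices n)" for i
    using borel_measurable_deficit by measurable
  have Y_int: "integrable (choices n) (?Y i)" if "i < n" for i
    using Y_meas Y_nn[OF that] by (intro integrableI_nonneg) (auto simp: le_less_trans)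
  have Y_le: "(\<integral>\<omega>. ?Y i \<omega> \<partial>choices n) \<le> 1" if "i < n" for i
    using Y_nn[OF that] Y_int[OF that] by (simp add: nn_integral_eq_integral)
  have sum_int: "integrable (choices n) (\<lambda>\<omega>. (\<Sum>i<n. ?Y i \<omega>) / l)"
    using Y_int l by (intro integrable_divide Bochner_Integration.integrable_sum) auto
  note ae = AE_choices_less[OF n]
  \<comment> \<open>\<open>Random\<close> lies between 0 and \<open>OPT\<close> almost everywhere,
    and \<open>OPT\<close> is integrable by assumption.\<close>
  have R_int: "integrable (choices n) (Random n adv)"
  proof (rule Bochner_Integration.integrable_bound[OF int borel_measurable_Random])
    show "AE \<omega> in choices n. norm (Random n adv \<omega>) \<le> norm (OPT n (input_seq adv \<omega>))"
      using ae
    proof eventually_elim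
      case (elim \<omega>)
      then show ?case using Random_bounds(1,2)[OF n adv, of \<omega>] by simp
    qed
  qed
  \<comment> \<open>Each of the \<open>n\<close> exponentials has expectation at most 1, so together
    they cost \<open>n / l\<close>.\<close>
  have "(1 - l / 2) / n * (\<integral>\<omega>. OPT n (input_seq adv \<omega>) \<partial>choices n) - n / l
      \<le> (1 - l / 2) / n * (\<integral>\<omega>. OPT n (input_seq adv \<omega>) \<partial>choices n)
        - (\<Sum>i<n. \<integral>\<omega>. ?Y i \<omega> \<partial>choices n) / l"
    using sum_mono[of "{..<n}" "\<lambda>i. \<integral>\<omega>. ?Y i \<omega> \<partial>choices n" "\<lambda>_. 1"] Y_le l
    by (simp add: divide_right_mono)
  also have "\<dots> = (\<integral>\<omega>. (1 - l / 2) / n * OPT n (input_seq adv \<omega>)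
      - (\<Sum>i<n. ?Y i \<omega>) / l \<partial>choices n)"
    using int Y_int sum_int by (subst Bochner_Integration.integral_diff) auto
  also have "\<dots> \<le> (\<integral>\<omega>. Random n adv \<omega> \<partial>choices n)"
  proof (rule integral_mono_AE)
    show "AE \<omega> in choices n. (1 - l / 2) / n * OPT n (input_seq adv \<omega>)
      - (\<Sum>i<n. ?Y i \<omega>) / l \<le> Random n adv \<omega>"
      using ae
    proof eventually_elim
      case (elim \<omega>)
      then show ?case using Random_bounds(3)[OF n adv _ l, of \<omega>] by simp
    qed
  qed (use int sum_int R_int in auto)
  finally show ?thesis .
qed

theorem theorem1:
  fixes n :: nat
  assumes "n \<ge> 1"
  shows "\<exists>C K :: real. C > 0 \<and> K > 0 \<and>
    (\<forall>adv. valid_adversary n adv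
       \<longrightarrow> (AE \<omega> in choices n. terminates adv \<omega>)
       \<longrightarrow> integrable (choices n) (\<lambda>\<omega>. OPT n (input_seq adv \<omega>))
       \<longrightarrow> (let Opt = (\<integral>\<omega>. OPT n (input_seq adv \<omega>) \<partial>choices n) in
             Opt \<ge> K \<longrightarrow>
             (\<integral>\<omega>. Random n adv \<omega> \<partial>choices n) \<ge> Opt / real n - C * sqrt (Opt * ln Opt)))"
proof (rule exI[of _ "real n + 1"], rule exI[of _ 3], intro conjI allI impI)
  \<comment> \<open>With \<open>l = 1 / sqrt M\<close> the loss is
    \<open>sqrt M / (2 * n) + n * sqrt M\<close>, at most \<open>(n + 1) * sqrt M\<close>; this is
    the constant \<open>C\<close>. The threshold 3 exceeds \<open>exp 1\<close>, so
    \<open>ln M \<ge> 1\<close> and the logarithm can be inserted under the root; it also makes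
    \<open>l\<close> at most 1.\<close>
  fix adv
  assume adv: "valid_adversary n adv" and ends: "AE \<omega> in choices n. terminates adv \<omega>"
    and int: "integrable (choices n) (\<lambda>\<omega>. OPT n (input_seq adv \<omega>))"
  define M where "M = (\<integral>\<omega>. OPT n (input_seq adv \<omega>) \<partial>choices n)"
  have "M / n - (real n + 1) * sqrt (M * ln M) \<le> (\<integral>\<omega>. Random n adv \<omega> \<partial>choices n)" if M: "3 \<le> M"
  proof -
    define r where "r = sqrt M"
    have r: "1 \<le> r" "r * r = M" using M by (auto simp: r_def)
    have "1 \<le> ln M"
      using M exp_le by (subst ln_ge_iff) auto
    then have "r \<le> sqrt (M * ln M)"
      using M unfolding r_def by (intro real_sqrt_le_mono) (simp add: mult_left_le)
    then have "(real n + 1) * r \<le> (real n + 1) * sqrt (M * ln M)"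
      by (intro mult_left_mono) auto
    moreover have "r / (2 * n) \<le> r"
      using r assms by (simp add: field_simps)
    moreover have "(1 - (1 / r) / 2) / n * M - n / (1 / r) = M / n - r / (2 * n) - n * r"
      using r(1) assms unfolding r(2)[symmetric] by (simp add: field_simps)
    moreover have "(1 - (1 / r) / 2) / n * M - n / (1 / r) \<le> (\<integral>\<omega>. Random n adv \<omega> \<partial>choices n)"
      unfolding M_def by (rule expected_Random_ge[OF assms adv ends int]) (use r in \<open>auto simp: field_simps\<close>)
    ultimately show ?thesis by (simp add: algebra_simps)
  qed
  then show "let Opt = (\<integral>\<omega>. OPT n (input_seq adv \<omega>) \<partial>choices n) in
      Opt \<ge> 3 \<longrightarrow>
      (\<integral>\<omega>. Random n adv \<omega> \<partial>choices n) \<ge> Opt / real n - (real n + 1) * sqrt (Opt * ln Opt)"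
    by (simp add: Let_def M_def)
qed auto

end
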